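(* Let $Q>0$ and $K\ge1$. Suppose that $(X,\rho,\mu)$ is a bounded Ahlfors $Q$-regular $K$-quasi-metric measure space and let $c\in X$. Then the flattening $(X^c,\rho^c,\mu^c)$ of $X$ with respect to $c$ is an unbounded Ahlfors $Q$-regular $K''$-quasi-metric measure space, where $K''=K^2$.
   Context: A $K$-quasi-metric ($K\ge1$) on a set $X$ is a symmetric function $\rho:X\times X\to[0,\infty)$ with $\rho(x,y)=0$ iff $x=y$ and $\rho(x,z)\le K\max\{\rho(x,y),\rho(y,z)\}$ for all $x,y,z\in X$. Balls are $B(x,r)=\{y\in X:\rho(x,y)<r\}$. The quasi-metric space $(X,\rho)$ with positive Borel measure $\mu$ (Borel regular, with dense support) is Ahlfors $Q$-regular if there is $C\ge1$ with $C^{-1}R^Q\le\mu(B(x,R))\le CR^Q$ for all $x\in X$ and $0<R<\operatorname{diam}_\rho(X)$ (possibly $\operatorname{diam}_\rho(X)=\infty$). Flattening: for bounded $(X,\rho)$ and $c\in X$, let $X^c=X\setminus\{c\}$ and define $\rho^c(x,y)=\dfrac{\rho(x,y)}{\rho(x,c)\rho(y,c)}$ for $x,y\in X^c$. The flattening measure is $\mu^c(A)=\displaystyle\int_A\frac{1}{\mu(B(c,\rho(c,z)))^2}\,d\mu(z)$ for Borel sets $A\subset X^c$.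
   Formalization: The formal theorem also assumes that balls of X have finite measure (so μ(X) is finite) and that X is not just {c}; without these the claim fails, e.g. for infinitely many disjoint Cantor sets at mutual distance 1, or for a one-point X. *)

theory Defs
  imports "HOL-Analysis.Analysis"
begin

definition quasi_metric :: "real \<Rightarrow> 'a set \<Rightarrow> ('a \<Rightarrow> 'a \<Rightarrow> real) \<Rightarrow> bool" where
  "quasi_metric K X \<rho> \<longleftrightarrow>
     K \<ge> 1 \<and>
     (\<forall>x\<in>X. \<forall>y\<in>X. 0 \<le> \<rho> x y) \<and>
     (\<forall>x\<in>X. \<forall>y\<in>X. \<rho> x y = \<rho> y x) \<and>
     (\<forall>x\<in>X. \<forall>y\<in>X. \<rho> x y = 0 \<longleftrightarrow> x = y) \<and>
     (\<forall>x\<in>X. \<forall>y\<in>X. \<forall>z\<in>X. \<rho> x z \<le> K * max (\<rho> x y) (\<rho> y z))"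

definition qball :: "'a set \<Rightarrow> ('a \<Rightarrow> 'a \<Rightarrow> real) \<Rightarrow> 'a \<Rightarrow> real \<Rightarrow> 'a set" where
  "qball X \<rho> x r = {y \<in> X. \<rho> x y < r}"

definition qdiam :: "'a set \<Rightarrow> ('a \<Rightarrow> 'a \<Rightarrow> real) \<Rightarrow> ennreal" where
  "qdiam X \<rho> = (SUP x\<in>X. SUP y\<in>X. ennreal (\<rho> x y))"

definition qbounded :: "'a set \<Rightarrow> ('a \<Rightarrow> 'a \<Rightarrow> real) \<Rightarrow> bool" where
  "qbounded X \<rho> \<longleftrightarrow> qdiam X \<rho> < \<infinity>"

(* Balls of a quasi-metric need not be open (nor even Borel) in this topology. *)
definition qtopology :: "'a set \<Rightarrow> ('a \<Rightarrow> 'a \<Rightarrow> real) \<Rightarrow> 'a topology" where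
  "qtopology X \<rho> =
     topology (\<lambda>U. U \<subseteq> X \<and> (\<forall>x\<in>U. \<exists>r>0. qball X \<rho> x r \<subseteq> U))"

lemma openin_qtopology:
  "openin (qtopology X \<rho>) U \<longleftrightarrow> U \<subseteq> X \<and> (\<forall>x\<in>U. \<exists>r>0. qball X \<rho> x r \<subseteq> U)"
proof -
  have "istopology (\<lambda>U. U \<subseteq> X \<and> (\<forall>x\<in>U. \<exists>r>0. qball X \<rho> x r \<subseteq> U))"
    unfolding istopology_def
  proof (intro conjI allI impI ballI)
    fix S T x
    assume S: "S \<subseteq> X \<and> (\<forall>x\<in>S. \<exists>r>0. qball X \<rho> x r \<subseteq> S)"
      and T: "T \<subseteq> X \<and> (\<forall>x\<in>T. \<exists>r>0. qball X \<rho> x r \<subseteq> T)"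
      and x: "x \<in> S \<inter> T"
    obtain r where r: "r > 0" "qball X \<rho> x r \<subseteq> S" using S x by blast
    obtain s where s: "s > 0" "qball X \<rho> x s \<subseteq> T" using T x by blast
    have "qball X \<rho> x (min r s) \<subseteq> S \<inter> T"
      using r(2) s(2) by (auto simp: qball_def)
    with r(1) s(1) show "\<exists>r>0. qball X \<rho> x r \<subseteq> S \<inter> T"
      by (intro exI[of _ "min r s"]) auto
  next
    fix \<K> x
    assume K: "\<forall>S\<in>\<K>. S \<subseteq> X \<and> (\<forall>x\<in>S. \<exists>r>0. qball X \<rho> x r \<subseteq> S)"
      and x: "x \<in> \<Union> \<K>"
    then obtain S where "S \<in> \<K>" "x \<in> S" by blast
    with K obtain r where "r > 0" "qball X \<rho> x r \<subseteq> S" by blast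
    with \<open>S \<in> \<K>\<close> show "\<exists>r>0. qball X \<rho> x r \<subseteq> \<Union> \<K>" by blast
  qed blast+
  then show ?thesis
    by (simp add: qtopology_def)
qed

definition qborel :: "'a set \<Rightarrow> ('a \<Rightarrow> 'a \<Rightarrow> real) \<Rightarrow> 'a set set" where
  "qborel X \<rho> = sigma_sets X {U. openin (qtopology X \<rho>) U}"

definition qsupport :: "'a set \<Rightarrow> ('a \<Rightarrow> 'a \<Rightarrow> real) \<Rightarrow> 'a measure \<Rightarrow> 'a set" where
  "qsupport X \<rho> M =
     {x \<in> X. \<forall>U. openin (qtopology X \<rho>) U \<and> x \<in> U \<longrightarrow> 0 < emeasure M U}"

(* Since balls need not be Borel, the measure of a ball is always read through the outer
   measure that M induces on all subsets; it is emeasure M whenever the ball is measurable.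
   Finiteness on balls is the usual convention for metric measure spaces. Ahlfors regularity
   alone does not give it: countably many Cantor sets of diameter 1/2, at mutual distance 1,
   form a bounded Ahlfors regular space of infinite total measure, whose flattening has balls
   of infinite measure. *)
definition quasi_metric_measure_space ::
    "real \<Rightarrow> 'a set \<Rightarrow> ('a \<Rightarrow> 'a \<Rightarrow> real) \<Rightarrow> 'a measure \<Rightarrow> bool" where
  "quasi_metric_measure_space K X \<rho> M \<longleftrightarrow>
     quasi_metric K X \<rho> \<and>
     space M = X \<and>
     qborel X \<rho> \<subseteq> sets M \<and>
     (\<forall>A\<in>sets M. \<exists>B\<in>qborel X \<rho>. A \<subseteq> B \<and> emeasure M B = emeasure M A) \<and>
     qtopology X \<rho> closure_of qsupport X \<rho> M = X \<and>
     (\<forall>x\<in>X. \<forall>r>0. outer_measure_of M (qball X \<rho> x r) < \<infinity>)"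

definition ahlfors_regular ::
    "real \<Rightarrow> 'a set \<Rightarrow> ('a \<Rightarrow> 'a \<Rightarrow> real) \<Rightarrow> 'a measure \<Rightarrow> bool" where
  "ahlfors_regular Q X \<rho> M \<longleftrightarrow>
     (\<exists>C\<ge>1. \<forall>x\<in>X. \<forall>R>0. ennreal R < qdiam X \<rho> \<longrightarrow>
        ennreal (inverse C * R powr Q) \<le> outer_measure_of M (qball X \<rho> x R) \<and>
        outer_measure_of M (qball X \<rho> x R) \<le> ennreal (C * R powr Q))"

definition flat_dist :: "('a \<Rightarrow> 'a \<Rightarrow> real) \<Rightarrow> 'a \<Rightarrow> 'a \<Rightarrow> 'a \<Rightarrow> real" where
  "flat_dist \<rho> c x y = \<rho> x y / (\<rho> x c * \<rho> y c)"

(* A measure on the Borel sets of the flattened space. If balls centred at c are not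
   measurable, the integrand may be non-measurable, and the integral is then the lower
   integral (the supremum over simple functions below the integrand), which is what
   nn_integral denotes; it is still countably additive in A. *)
definition flat_measure ::
    "'a set \<Rightarrow> ('a \<Rightarrow> 'a \<Rightarrow> real) \<Rightarrow> 'a measure \<Rightarrow> 'a \<Rightarrow> 'a measure" where
  "flat_measure X \<rho> M c =
     measure_of (X - {c}) (qborel (X - {c}) (flat_dist \<rho> c))
       (\<lambda>A. \<integral>\<^sup>+z\<in>A. 1 / (outer_measure_of M (qball X \<rho> c (\<rho> c z)))\<^sup>2 \<partial>M)"

end

theory Submission
  imports Defs
begin

text \<open>The quasi-metric axiom for the flattening is a Ptolemy inequality with constant K^2. On a
  bounded space the flattened topology is the subspace topology of X - {c}, and the density of the
  flattening measure at z is comparable to the power -2Q of the distance d(z, c). A flattened ball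
  of radius R about x is, if R d(x, c) is small, comparable to a ball about x of radius
  R d(x, c)^2 on which d(., c) is comparable to d(x, c). Otherwise it is contained in the set where
  d(., c) is at least a multiple of 1/R, whose measure is bounded by summing over dyadic rings
  about c, and it contains a ball of radius comparable to 1/R at distance comparable to 1/R from c.
  As balls need not be Borel, they are replaced by open sets lying between two concentric
  balls.\<close>

text \<open>Write \<delta> for the distance from x to c. The exponents balance in both regimes. If R
  \<delta> is small, a set of mass about (R \<delta>^2)^Q carries density about \<delta>^(-2Q);
  otherwise the relevant distance to c is 1/R, and mass R^(-Q) meets density R^(2Q). Either product
  is R^Q. That there are points at distance about 1/R from c is not a matter of connectedness: X may
  have gaps, and only the two mass bounds together exclude an empty ring about c that is too thick.
  The same rings make c an accumulation point, which is why the flattening is unbounded.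
  Measurability is the other obstacle. Neither a ball nor the density has to be measurable, so the
  density is never integrated exactly: it is bounded by constants on Borel sets, and the outer
  measures of balls are compared with the measures of such sets.\<close>

section \<open>Open sets between concentric balls\<close>

text \<open>The points reachable from x by finitely many jumps of lengths below r, r/K, r/K^2, ...
  form an open set; the decay of the jumps keeps it inside the ball of radius K r.\<close>

inductive qchain :: "real \<Rightarrow> 'a set \<Rightarrow> ('a \<Rightarrow> 'a \<Rightarrow> real) \<Rightarrow> 'a \<Rightarrow> real \<Rightarrow> 'a \<Rightarrow> bool"
  for K X \<rho> where
  base: "\<lbrakk>x \<in> X; z \<in> qball X \<rho> x r\<rbrakk> \<Longrightarrow> qchain K X \<rho> x r z"
| step: "\<lbrakk>x \<in> X; y \<in> qball X \<rho> x r; qchain K X \<rho> y (r / K) z\<rbrakk> \<Longrightarrow> qchain K X \<rho> x r z"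

text \<open>After the first jump the rest of the chain starts with radius \<open>r / K\<close>, so
  inductively it ends within \<open>K * (r / K) = r\<close> of \<open>y\<close>. Both terms of the
  maximum are then below \<open>r\<close>, and a single factor \<open>K\<close> is paid, however
  long the chain.\<close>

lemma qchain_less:
  assumes "quasi_metric K X \<rho>" "qchain K X \<rho> x r z"
  shows "z \<in> X \<and> \<rho> x z < K * r"
  using assms(2)
proof induction
  case (base x z r)
  have "0 \<le> \<rho> x z" "K \<ge> 1" and "z \<in> X" "\<rho> x z < r"
    using assms(1) base by (auto simp: quasi_metric_def qball_def)
  moreover have "r \<le> K * r"
    using calculation by (simp add: mult_le_cancel_right1)
  ultimately show ?case by linarith
next
  case (step x y r z)
  have K: "K \<ge> 1" using assms(1) by (simp add: quasi_metric_def)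
  have y: "y \<in> X" "\<rho> x y < r" using step by (auto simp: qball_def)
  have yz: "\<rho> y z < r" "z \<in> X" using step K by auto
  have "\<rho> x z \<le> K * max (\<rho> x y) (\<rho> y z)"
    using assms(1) step(1) y yz unfolding quasi_metric_def by blast
  also have "\<dots> < K * r"
    using K y yz by (intro mult_strict_left_mono) auto
  finally show ?case using yz by simp
qed

text \<open>A chain can always be prolonged by one jump shorter than its last one by a factor
  \<open>K\<close>. No slack between \<open>\<rho> x z\<close> and the radius is involved, which in
  a quasi-metric would not help.\<close>

lemma qchain_open:
  assumes "K > 0" "qchain K X \<rho> x r z" "r > 0" "z \<in> X"
  shows "\<exists>s>0. \<forall>w\<in>qball X \<rho> z s. qchain K X \<rho> x r w"
  using assms(2-)
proof induction
  case (base x z r)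
  then show ?case
    using \<open>K > 0\<close> by (intro exI[of _ "r / K"]) (auto intro: qchain.intros)
next
  case (step x y r z)
  then obtain s where "s > 0" "\<forall>w\<in>qball X \<rho> z s. qchain K X \<rho> y (r / K) w"
    using \<open>K > 0\<close> by auto
  with step show ?case by (auto intro: qchain.intros)
qed

lemma qball_open_between:
  assumes qm: "quasi_metric K X \<rho>" and "x \<in> X" "r > 0"
  obtains V where "openin (qtopology X \<rho>) V" "qball X \<rho> x r \<subseteq> V" "V \<subseteq> qball X \<rho> x (K * r)"
proof
  have K: "K > 0" using qm by (simp add: quasi_metric_def)
  let ?V = "{z. qchain K X \<rho> x r z}"
  show sub: "?V \<subseteq> qball X \<rho> x (K * r)"
    using qchain_less[OF qm] by (auto simp: qball_def)
  then have "?V \<subseteq> X" by (auto simp: qball_def)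
  then show "openin (qtopology X \<rho>) ?V"
    unfolding openin_qtopology
  proof (intro conjI ballI)
    fix z
    assume "?V \<subseteq> X" and z: "z \<in> ?V"
    then obtain s where "s > 0" "\<forall>w\<in>qball X \<rho> z s. qchain K X \<rho> x r w"
      using qchain_open[OF K _ \<open>r > 0\<close>, of X \<rho> x z] by auto
    then show "\<exists>s>0. qball X \<rho> z s \<subseteq> ?V" by auto
  qed
  show "qball X \<rho> x r \<subseteq> ?V"
    using \<open>x \<in> X\<close> by (auto intro: qchain.base)
qed

section \<open>Lower integrals of arbitrary functions\<close>

text \<open>The integrand below need not be measurable, so additivity of the lower integral in its
  domain of integration has to be proved.\<close>

lemma nn_integral_measurable_minorant:
  fixes f :: "'a \<Rightarrow> ennreal"
  obtains g where "g \<in> borel_measurable M" "\<And>x. g x \<le> f x" "integral\<^sup>N M g = integral\<^sup>N M f"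
proof -
  let ?S = "{g. simple_function M g \<and> g \<le> f}"
  have "(\<lambda>_. 0) \<in> ?S" by (simp add: le_fun_def)
  then have "integral\<^sup>S M ` ?S \<noteq> {}" by blast
  from ennreal_Sup_countable_SUP[OF this] obtain a :: "nat \<Rightarrow> ennreal"
    where "incseq a \<and> range a \<subseteq> integral\<^sup>S M ` ?S \<and> Sup (integral\<^sup>S M ` ?S) = (SUP i. a i)" ..
  then have a: "a i \<in> integral\<^sup>S M ` ?S" and Sup: "integral\<^sup>N M f = (SUP i. a i)" for i
    by (auto simp only: nn_integral_def image_subset_iff)
  from a have "\<forall>i. \<exists>h. h \<in> ?S \<and> a i = integral\<^sup>S M h"
    unfolding image_iff Bex_def by blast
  from choice[OF this] obtain h where "\<forall>i. h i \<in> ?S \<and> a i = integral\<^sup>S M (h i)" ..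
  then have h: "h i \<in> ?S" "a i = integral\<^sup>S M (h i)" for i by auto
  \<comment> \<open>The lower integral is a supremum over simple functions; countably many of them
    suffice to reach it, and their pointwise supremum is measurable and still below
    \<open>f\<close>.\<close>
  define g where "g x = (SUP i. h i x)" for x
  show ?thesis
  proof
    have [measurable]: "h i \<in> borel_measurable M" for i
      using h(1)[of i] by (auto intro: borel_measurable_simple_function)
    show "g \<in> borel_measurable M" unfolding g_def by measurable
    show le: "g x \<le> f x" for x
      using h(1) unfolding g_def by (auto intro!: SUP_least simp: le_fun_def)
    show "integral\<^sup>N M g = integral\<^sup>N M f"
    proof (rule antisym)
      show "integral\<^sup>N M g \<le> integral\<^sup>N M f" using le by (intro nn_integral_mono)
      have "a i \<le> integral\<^sup>N M g" for i
      proof -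
        have "a i = integral\<^sup>N M (h i)"
          using h[of i] by (simp add: nn_integral_eq_simple_integral)
        also have "\<dots> \<le> integral\<^sup>N M g"
          unfolding g_def by (intro nn_integral_mono SUP_upper) simp
        finally show ?thesis .
      qed
      then show "integral\<^sup>N M f \<le> integral\<^sup>N M g"
        unfolding Sup by (intro SUP_least)
    qed
  qed
qed

text \<open>Both inequalities replace \<open>f\<close> by measurable minorants with the same lower
  integral. One minorant for each \<open>A i\<close> can be summed, by disjointness, to a minorant
  on the union; conversely a minorant on the union vanishes outside it and splits into its
  restrictions to the measurable sets \<open>A i\<close>.\<close>

lemma countably_additive_set_nn_integral:
  fixes f :: "'a \<Rightarrow> ennreal"
  assumes "\<A> \<subseteq> sets M"
  shows "countably_additive \<A> (\<lambda>A. \<integral>\<^sup>+z\<in>A. f z \<partial>M)"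
proof (rule countably_additiveI)
  fix A :: "nat \<Rightarrow> 'a set"
  assume "range A \<subseteq> \<A>" and disj: "disjoint_family A"
  with assms have [measurable]: "\<And>i. A i \<in> sets M" by auto
  have split: "(\<Sum>i. u * indicator (A i) x) = u * indicator (\<Union>i. A i) x" for u :: ennreal and x
    by (simp add: ennreal_suminf_cmult suminf_indicator[OF disj])
  show "(\<Sum>i. \<integral>\<^sup>+z\<in>A i. f z \<partial>M) = (\<integral>\<^sup>+z\<in>(\<Union>i. A i). f z \<partial>M)"
  proof (rule antisym)
    have "\<forall>i. \<exists>g. g \<in> borel_measurable M \<and> (\<forall>x. g x \<le> f x * indicator (A i) x)
        \<and> integral\<^sup>N M g = (\<integral>\<^sup>+z\<in>A i. f z \<partial>M)"
    proof
      fix i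
      show "\<exists>g. g \<in> borel_measurable M \<and> (\<forall>x. g x \<le> f x * indicator (A i) x)
          \<and> integral\<^sup>N M g = (\<integral>\<^sup>+z\<in>A i. f z \<partial>M)"
        by (rule nn_integral_measurable_minorant[of M "\<lambda>x. f x * indicator (A i) x"]) blast
    qed
    from choice[OF this] obtain g where [measurable]: "\<And>i. g i \<in> borel_measurable M"
      and g: "\<And>i x. g i x \<le> f x * indicator (A i) x"
      and int: "\<And>i. integral\<^sup>N M (g i) = (\<integral>\<^sup>+z\<in>A i. f z \<partial>M)"
      by blast
    have "(\<Sum>i. \<integral>\<^sup>+z\<in>A i. f z \<partial>M) = (\<integral>\<^sup>+x. (\<Sum>i. g i x) \<partial>M)"
      by (simp add: nn_integral_suminf int)
    also have "\<dots> \<le> (\<integral>\<^sup>+x. (\<Sum>i. f x * indicator (A i) x) \<partial>M)"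
      by (intro nn_integral_mono suminf_le g) auto
    finally show "(\<Sum>i. \<integral>\<^sup>+z\<in>A i. f z \<partial>M) \<le> (\<integral>\<^sup>+z\<in>(\<Union>i. A i). f z \<partial>M)"
      by (simp only: split)
  next
    obtain g where [measurable]: "g \<in> borel_measurable M"
      and g: "\<And>x. g x \<le> f x * indicator (\<Union>i. A i) x"
      and int: "integral\<^sup>N M g = (\<integral>\<^sup>+z\<in>(\<Union>i. A i). f z \<partial>M)"
      using nn_integral_measurable_minorant[of M "\<lambda>x. f x * indicator (\<Union>i. A i) x"] by blast
    have "g x = g x * indicator (\<Union>i. A i) x" for x
      using g[of x] by (auto split: split_indicator)
    then have "g x = (\<Sum>i. g x * indicator (A i) x)" for x
      by (simp only: split)
    then have "integral\<^sup>N M g = (\<integral>\<^sup>+x. (\<Sum>i. g x * indicator (A i) x) \<partial>M)"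
      by (intro nn_integral_cong) blast
    also have "\<dots> = (\<Sum>i. \<integral>\<^sup>+x. g x * indicator (A i) x \<partial>M)"
      by (intro nn_integral_suminf) measurable
    also have "\<dots> \<le> (\<Sum>i. \<integral>\<^sup>+z\<in>A i. f z \<partial>M)"
    proof (intro suminf_le nn_integral_mono)
      fix i x
      have "g x \<le> f x" if "x \<in> A i"
        using g[of x] that by (auto split: split_indicator_asm)
      then show "g x * indicator (A i) x \<le> f x * indicator (A i) x"
        by (auto split: split_indicator)
    qed auto
    finally show "(\<integral>\<^sup>+z\<in>(\<Union>i. A i). f z \<partial>M) \<le> (\<Sum>i. \<integral>\<^sup>+z\<in>A i. f z \<partial>M)"
      by (simp add: int)
  qed
qed

section \<open>Basic facts on the topology, its Borel sets and the diameter\<close>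

lemma sigma_algebra_qborel: "sigma_algebra X (qborel X \<rho>)"
  unfolding qborel_def by (rule sigma_algebra_sigma_sets) (auto simp: openin_qtopology)

lemma le_qdiam: "\<lbrakk>x \<in> X; y \<in> X\<rbrakk> \<Longrightarrow> ennreal (\<rho> x y) \<le> qdiam X \<rho>"
  unfolding qdiam_def by (rule SUP_upper2[of x], assumption, rule SUP_upper)

lemma topspace_qtopology: "topspace (qtopology X \<rho>) = X"
proof (rule antisym)
  show "topspace (qtopology X \<rho>) \<subseteq> X"
    using iffD1[OF openin_qtopology openin_topspace] by (rule conjunct1)
  have "openin (qtopology X \<rho>) X"
    unfolding openin_qtopology by (auto simp: qball_def intro: exI[of _ 1])
  then show "X \<subseteq> topspace (qtopology X \<rho>)" by (rule openin_subset)
qed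

lemma inverse_antimono_ennreal: "a \<le> b \<Longrightarrow> inverse b \<le> inverse (a :: ennreal)"
  by (cases a; cases b; cases "a = 0") (auto simp: inverse_ennreal top_unique)

section \<open>Metric and topology of the flattening\<close>

locale pointed_quasi_metric =
  fixes K :: real and X :: "'a set" and \<rho> :: "'a \<Rightarrow> 'a \<Rightarrow> real" and c :: 'a and D :: real
  assumes qm: "quasi_metric K X \<rho>" and c: "c \<in> X" and D: "D > 0"
    and diam: "\<lbrakk>x \<in> X; y \<in> X\<rbrakk> \<Longrightarrow> \<rho> x y \<le> D"
begin

abbreviation "\<rho>c \<equiv> flat_dist \<rho> c"
abbreviation "Xc \<equiv> X - {c}"

lemma K: "K \<ge> 1"
  using qm by (simp add: quasi_metric_def)

lemma dist_nonneg: "\<lbrakk>x \<in> X; y \<in> X\<rbrakk> \<Longrightarrow> 0 \<le> \<rho> x y"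
  using qm by (simp add: quasi_metric_def)

lemma dist_sym: "\<lbrakk>x \<in> X; y \<in> X\<rbrakk> \<Longrightarrow> \<rho> x y = \<rho> y x"
  using qm by (simp add: quasi_metric_def)

lemma dist_eq_0: "\<lbrakk>x \<in> X; y \<in> X\<rbrakk> \<Longrightarrow> \<rho> x y = 0 \<longleftrightarrow> x = y"
  using qm by (simp add: quasi_metric_def)

lemma dist_triangle: "\<lbrakk>x \<in> X; y \<in> X; z \<in> X\<rbrakk> \<Longrightarrow> \<rho> x z \<le> K * max (\<rho> x y) (\<rho> y z)"
  using qm by (simp add: quasi_metric_def)

lemma dist_pos: "\<lbrakk>x \<in> X; y \<in> X; x \<noteq> y\<rbrakk> \<Longrightarrow> 0 < \<rho> x y"
  using dist_nonneg dist_eq_0 by (simp add: less_le)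

text \<open>In the quadrilateral x, y, z, w some side is no longer than its two neighbours. It drops
  out of the maximum in both triangles that contain it, so the diagonals are at most
  \<open>K\<close> times those two neighbours, which are opposite sides. The four cases say which
  side is chosen.\<close>

lemma quasi_ptolemy:
  assumes "x \<in> X" "y \<in> X" "z \<in> X" "w \<in> X"
  shows "\<rho> x z * \<rho> y w \<le> K\<^sup>2 * max (\<rho> x y * \<rho> z w) (\<rho> y z * \<rho> x w)"
proof -
  let ?p = "\<rho> x y" and ?q = "\<rho> y z" and ?r = "\<rho> x w" and ?s = "\<rho> z w"
  have nn: "0 \<le> ?p" "0 \<le> ?q" "0 \<le> ?r" "0 \<le> ?s" "0 \<le> \<rho> x z" "0 \<le> \<rho> y w"
    using assms dist_nonneg by auto
  have xz: "\<rho> x z \<le> K * max ?p ?q" "\<rho> x z \<le> K * max ?r ?s"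
    using dist_triangle[of x y z] dist_triangle[of x w z] dist_sym[of w z] assms by auto
  have yw: "\<rho> y w \<le> K * max ?p ?r" "\<rho> y w \<le> K * max ?q ?s"
    using dist_triangle[of y x w] dist_triangle[of y z w] dist_sym[of y x] assms by auto
  have prod: ?thesis
    if "\<rho> x z \<le> K * a" "\<rho> y w \<le> K * b" "0 \<le> a" "a * b \<le> max (?p * ?s) (?q * ?r)" for a b
  proof -
    have "\<rho> x z * \<rho> y w \<le> (K * a) * (K * b)"
      using that nn K by (intro mult_mono) auto
    also have "\<dots> = K\<^sup>2 * (a * b)" by (simp add: power2_eq_square algebra_simps)
    also have "\<dots> \<le> K\<^sup>2 * max (?p * ?s) (?q * ?r)"
      using that by (intro mult_left_mono) auto
    finally show ?thesis .
  qed
  consider "?r \<le> ?s" "?r \<le> ?p" | "?s \<le> ?r" "?s \<le> ?q"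
    | "?p \<le> ?q" "?p \<le> ?r" | "?q \<le> ?p" "?q \<le> ?s"
    by linarith
  then show ?thesis
  proof cases
    case 1
    then have "max ?r ?s = ?s" "max ?p ?r = ?p" by auto
    with xz(2) yw(1) nn show ?thesis
      by (intro prod[of ?s ?p]) (auto simp: mult.commute[of ?s])
  next
    case 2
    then have "max ?r ?s = ?r" "max ?q ?s = ?q" by auto
    with xz(2) yw(2) nn show ?thesis
      by (intro prod[of ?r ?q]) (auto simp: mult.commute[of ?r])
  next
    case 3
    then have "max ?p ?q = ?q" "max ?p ?r = ?r" by auto
    with xz(1) yw(1) nn show ?thesis
      by (intro prod[of ?q ?r]) (auto simp: mult.commute[of ?q])
  next
    case 4
    then have "max ?p ?q = ?p" "max ?q ?s = ?s" by auto
    with xz(1) yw(2) nn show ?thesis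
      by (intro prod[of ?p ?s]) (auto simp: mult.commute[of ?p])
  qed
qed

text \<open>Multiplied by \<open>\<rho> x c * \<rho> y c * \<rho> z c\<close>, the quasi-metric
  inequality of \<open>\<rho>c\<close> becomes \<open>quasi_ptolemy\<close> with \<open>c\<close> as
  fourth point.\<close>

lemma flat_quasi_metric: "quasi_metric (K\<^sup>2) Xc \<rho>c"
  unfolding quasi_metric_def
proof (intro conjI ballI)
  show "K\<^sup>2 \<ge> 1" using K by simp
next
  fix x y assume "x \<in> Xc" "y \<in> Xc"
  then have "0 < \<rho> x c" "0 < \<rho> y c" "x \<in> X" "y \<in> X" using c dist_pos by auto
  then show "0 \<le> \<rho>c x y" "\<rho>c x y = 0 \<longleftrightarrow> x = y" "\<rho>c x y = \<rho>c y x"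
    using dist_nonneg[of x y] dist_eq_0[of x y] dist_sym[of x y]
    by (auto simp: flat_dist_def mult.commute)
next
  fix x y z assume "x \<in> Xc" "y \<in> Xc" "z \<in> Xc"
  then have pos: "0 < \<rho> x c" "0 < \<rho> y c" "0 < \<rho> z c" and X: "x \<in> X" "y \<in> X" "z \<in> X"
    using c dist_pos by auto
  let ?P = "\<rho> x c * \<rho> y c * \<rho> z c"
  have "\<rho>c x z = \<rho> x z * \<rho> y c / ?P" "\<rho>c x y = \<rho> x y * \<rho> z c / ?P" "\<rho>c y z = \<rho> y z * \<rho> x c / ?P"
    using pos by (auto simp: flat_dist_def)
  moreover have "\<rho> x z * \<rho> y c / ?P \<le> K\<^sup>2 * max (\<rho> x y * \<rho> z c) (\<rho> y z * \<rho> x c) / ?P"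
    using quasi_ptolemy[OF X c] pos by (intro divide_right_mono) auto
  ultimately show "\<rho>c x z \<le> K\<^sup>2 * max (\<rho>c x y) (\<rho>c y z)"
    using pos by (simp only: max_divide_distrib_right times_divide_eq_right[symmetric]
        zero_le_mult_iff order.strict_implies_order simp_thms if_True)
qed

lemma far_from_base:
  assumes "x \<in> X" "y \<in> X" "\<rho> x y < \<rho> x c / K"
  shows "\<rho> x c / K \<le> \<rho> y c"
proof -
  have "\<rho> x c \<le> K * max (\<rho> x y) (\<rho> y c)" using dist_triangle assms c by blast
  then show ?thesis using assms K by (simp add: field_simps max_def split: if_splits)
qed

text \<open>The first bound on \<open>t\<close> keeps \<open>y\<close> at distance at least
  \<open>\<rho> x c / K\<close> from \<open>c\<close>, so the denominator of
  \<open>\<rho>c x y\<close> is at least \<open>(\<rho> x c)^2 / K\<close>; the second bound then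
  makes the quotient smaller than \<open>R\<close>.\<close>

lemma qball_subset_flat_ball:
  assumes "x \<in> Xc" "R > 0" "t \<le> \<rho> x c / K" "t \<le> R * (\<rho> x c)\<^sup>2 / K"
  shows "qball X \<rho> x t \<subseteq> qball Xc \<rho>c x R"
proof
  fix y assume "y \<in> qball X \<rho> x t"
  then have y: "y \<in> X" "\<rho> x y < t" by (auto simp: qball_def)
  have x: "x \<in> X" "0 < \<rho> x c" using assms c dist_pos by auto
  have far: "\<rho> x c / K \<le> \<rho> y c" using far_from_base x y assms by auto
  moreover have "0 < \<rho> x c / K" using x K by auto
  ultimately have pos: "0 < \<rho> y c" by linarith
  have "\<rho> x y < R * (\<rho> x c)\<^sup>2 / K" using y assms by linarith
  also have "\<dots> = R * \<rho> x c * (\<rho> x c / K)" by (simp add: power2_eq_square)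
  also have "\<dots> \<le> R * \<rho> x c * \<rho> y c" using far x assms by (intro mult_left_mono) auto
  finally have "\<rho>c x y < R" using pos x by (simp add: flat_dist_def field_simps)
  moreover have "y \<noteq> c" using pos dist_eq_0[of c c] c by auto
  ultimately show "y \<in> qball Xc \<rho>c x R" using y by (simp add: qball_def)
qed

lemma openin_punctured: "openin (qtopology X \<rho>) Xc"
  unfolding openin_qtopology
proof (intro conjI ballI)
  fix x assume "x \<in> Xc"
  then show "\<exists>r>0. qball X \<rho> x r \<subseteq> Xc"
    using dist_pos[of x c] c by (intro exI[of _ "\<rho> x c"]) (auto simp: qball_def)
qed auto

text \<open>Around a fixed \<open>x\<close> each kind of ball contains one of the other kind. One
  inclusion is \<open>qball_subset_flat_ball\<close>; the other rests on boundedness, since the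
  denominator of \<open>\<rho>c\<close> is at most \<open>D^2\<close>.\<close>

lemma openin_flat:
  "openin (qtopology Xc \<rho>c) U \<longleftrightarrow> openin (qtopology X \<rho>) U \<and> U \<subseteq> Xc"
proof
  assume "openin (qtopology Xc \<rho>c) U"
  then have U: "U \<subseteq> Xc \<and> (\<forall>x\<in>U. \<exists>r>0. qball Xc \<rho>c x r \<subseteq> U)"
    unfolding openin_qtopology .
  have "\<exists>s>0. qball X \<rho> x s \<subseteq> U" if "x \<in> U" for x
  proof -
    obtain r where r: "r > 0" "qball Xc \<rho>c x r \<subseteq> U" and x: "x \<in> Xc"
      using U \<open>x \<in> U\<close> by blast
    define s where "s = min (\<rho> x c / K) (r * (\<rho> x c)\<^sup>2 / K)"
    have "0 < \<rho> x c" using x c dist_pos by auto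
    then have "s > 0" using r K by (auto simp: s_def)
    moreover have "qball X \<rho> x s \<subseteq> qball Xc \<rho>c x r"
      using x r by (intro qball_subset_flat_ball) (auto simp: s_def)
    ultimately show ?thesis using r by blast
  qed
  then show "openin (qtopology X \<rho>) U \<and> U \<subseteq> Xc"
    using U by (auto simp: openin_qtopology)
next
  assume "openin (qtopology X \<rho>) U \<and> U \<subseteq> Xc"
  then have U: "(\<forall>x\<in>U. \<exists>r>0. qball X \<rho> x r \<subseteq> U) \<and> U \<subseteq> Xc"
    unfolding openin_qtopology by (elim conjE, intro conjI)
  have "\<exists>r>0. qball Xc \<rho>c x r \<subseteq> U" if "x \<in> U" for x
  proof -
    obtain s where s: "s > 0" "qball X \<rho> x s \<subseteq> U"
      using U \<open>x \<in> U\<close> by blast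
    have x: "x \<in> X" "x \<noteq> c" using U that by auto
    have "qball Xc \<rho>c x (s / D\<^sup>2) \<subseteq> qball X \<rho> x s"
    proof
      fix y assume "y \<in> qball Xc \<rho>c x (s / D\<^sup>2)"
      then have y: "y \<in> X" "y \<noteq> c" "\<rho>c x y < s / D\<^sup>2" by (auto simp: qball_def)
      have pos: "0 < \<rho> x c" "0 < \<rho> y c" using x y c dist_pos by auto
      have "\<rho> x y < s / D\<^sup>2 * (\<rho> x c * \<rho> y c)"
        using y pos by (simp add: flat_dist_def pos_divide_less_eq)
      also have "\<dots> \<le> s / D\<^sup>2 * (D * D)"
        using s pos D x y c diam by (intro mult_left_mono mult_mono) auto
      also have "\<dots> = s" using D by (simp add: power2_eq_square)
      finally show "y \<in> qball X \<rho> x s" using y by (simp add: qball_def)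
    qed
    then show ?thesis using s D by (intro exI[of _ "s / D\<^sup>2"]) auto
  qed
  then show "openin (qtopology Xc \<rho>c) U"
    using U by (simp add: openin_qtopology)
qed

text \<open>The open sets of the flattening are the traces of the open sets of \<open>X\<close>, so
  the same holds for the generated Borel sets; as \<open>Xc\<close> is itself Borel, these traces
  are the Borel sets inside \<open>Xc\<close>.\<close>

lemma qborel_flat: "qborel Xc \<rho>c = {A \<in> qborel X \<rho>. A \<subseteq> Xc}"
proof -
  let ?O = "{U. openin (qtopology X \<rho>) U}"
  have Xc: "Xc \<in> sigma_sets X ?O" using openin_punctured by auto
  have "(\<inter>) Xc ` ?O = {U. openin (qtopology Xc \<rho>c) U}"
  proof (intro equalityI subsetI)
    fix U assume "U \<in> (\<inter>) Xc ` ?O"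
    then show "U \<in> {U. openin (qtopology Xc \<rho>c) U}"
      using openin_punctured by (auto simp: openin_flat)
  next
    fix U assume "U \<in> {U. openin (qtopology Xc \<rho>c) U}"
    then have "U \<in> ?O" "U = Xc \<inter> U" by (auto simp: openin_flat)
    then show "U \<in> (\<inter>) Xc ` ?O" by (rule rev_image_eqI)
  qed
  then have "qborel Xc \<rho>c = (\<inter>) Xc ` qborel X \<rho>"
    unfolding qborel_def using sigma_sets_Int[OF Xc] by auto
  also have "\<dots> = {A \<in> qborel X \<rho>. A \<subseteq> Xc}"
  proof (intro equalityI subsetI)
    fix A assume "A \<in> (\<inter>) Xc ` qborel X \<rho>"
    then obtain B where B: "B \<in> qborel X \<rho>" "A = Xc \<inter> B" by auto
    interpret sigma_algebra X "qborel X \<rho>" by (rule sigma_algebra_qborel)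
    have "Xc \<inter> B \<in> qborel X \<rho>"
      using B Xc by (intro Int) (auto simp: qborel_def)
    then show "A \<in> {A \<in> qborel X \<rho>. A \<subseteq> Xc}" using B by auto
  next
    fix A assume "A \<in> {A \<in> qborel X \<rho>. A \<subseteq> Xc}"
    then have "A \<in> qborel X \<rho>" "A = Xc \<inter> A" by auto
    then show "A \<in> (\<inter>) Xc ` qborel X \<rho>" by (rule rev_image_eqI)
  qed
  finally show ?thesis .
qed

end

section \<open>The flattening measure and its density\<close>

text \<open>The upper bound is demanded for every radius because enlarging a ball by the factor
  \<open>K\<close> may exceed the diameter. The lower bound includes radius \<open>D\<close> because
  the density at \<open>z\<close> involves the ball of radius \<open>\<rho> c z\<close>, which may
  equal \<open>D\<close>.\<close>

locale pointed_ahlfors = pointed_quasi_metric K X \<rho> c D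
  for K :: real and X :: "'a set" and \<rho> c D +
  fixes M :: "'a measure" and Q C :: real
  assumes Q: "Q > 0" and C: "C > 0"
    and qborel_sets: "qborel X \<rho> \<subseteq> sets M"
    and upper: "\<lbrakk>x \<in> X; r > 0\<rbrakk> \<Longrightarrow> outer_measure_of M (qball X \<rho> x r) \<le> ennreal (C * r powr Q)"
    and lower: "\<lbrakk>x \<in> X; 0 < r; r \<le> D\<rbrakk> \<Longrightarrow> ennreal (r powr Q / C) \<le> outer_measure_of M (qball X \<rho> x r)"
begin

abbreviation "\<mu>c \<equiv> flat_measure X \<rho> M c"
abbreviation "flat_density \<equiv> \<lambda>z. 1 / (outer_measure_of M (qball X \<rho> c (\<rho> c z)))\<^sup>2"

lemma space_flat: "space \<mu>c = Xc"
  unfolding flat_measure_def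
  by (rule space_measure_of) (auto simp: qborel_flat)

lemma sets_flat: "sets \<mu>c = {A \<in> qborel X \<rho>. A \<subseteq> Xc}"
  unfolding flat_measure_def qborel_flat[symmetric]
  by (rule sigma_algebra.sets_measure_of_eq[OF sigma_algebra_qborel])

lemma emeasure_flat:
  assumes "A \<in> qborel X \<rho>" "A \<subseteq> Xc"
  shows "emeasure \<mu>c A = (\<integral>\<^sup>+z\<in>A. flat_density z \<partial>M)"
  unfolding flat_measure_def
proof (rule emeasure_measure_of_sigma[OF sigma_algebra_qborel])
  show "positive (qborel Xc \<rho>c) (\<lambda>A. \<integral>\<^sup>+z\<in>A. flat_density z \<partial>M)"
    by (simp add: positive_def)
  show "countably_additive (qborel Xc \<rho>c) (\<lambda>A. \<integral>\<^sup>+z\<in>A. flat_density z \<partial>M)"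
    using qborel_sets by (intro countably_additive_set_nn_integral) (auto simp: qborel_flat)
  show "A \<in> qborel Xc \<rho>c" using assms by (simp add: qborel_flat)
qed

lemma density_le:
  assumes "z \<in> Xc" "0 < s" "s \<le> \<rho> z c"
  shows "flat_density z \<le> ennreal ((C / s powr Q)\<^sup>2)"
proof -
  have z: "0 < \<rho> c z" "\<rho> c z \<le> D" "\<rho> c z = \<rho> z c"
    using assms c dist_pos diam dist_sym by auto
  have "ennreal (s powr Q / C) \<le> ennreal (\<rho> c z powr Q / C)"
    using assms z Q C by (intro ennreal_leI divide_right_mono powr_mono2) auto
  also have "\<dots> \<le> outer_measure_of M (qball X \<rho> c (\<rho> c z))"
    using lower[OF c] z by auto
  finally have "flat_density z \<le> 1 / (ennreal (s powr Q / C))\<^sup>2"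
    by (auto simp: divide_ennreal_def intro!: inverse_antimono_ennreal power_mono)
  also have "\<dots> = ennreal (1 / (s powr Q / C)\<^sup>2)"
    using assms C by (simp add: ennreal_power divide_ennreal flip: ennreal_1)
  also have "\<dots> = ennreal ((C / s powr Q)\<^sup>2)" by (simp add: power_divide)
  finally show ?thesis .
qed

lemma density_ge:
  assumes "z \<in> Xc" "\<rho> z c \<le> s"
  shows "ennreal ((1 / (C * s powr Q))\<^sup>2) \<le> flat_density z"
proof -
  have z: "0 < \<rho> c z" "\<rho> c z = \<rho> z c"
    using assms c dist_pos dist_sym by auto
  have "outer_measure_of M (qball X \<rho> c (\<rho> c z)) \<le> ennreal (C * \<rho> c z powr Q)"
    using upper[OF c] z by auto
  also have "\<dots> \<le> ennreal (C * s powr Q)"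
    using assms z Q C by (intro ennreal_leI mult_left_mono powr_mono2) auto
  finally have "1 / (ennreal (C * s powr Q))\<^sup>2 \<le> flat_density z"
    by (auto simp: divide_ennreal_def intro!: inverse_antimono_ennreal power_mono)
  also have "1 / (ennreal (C * s powr Q))\<^sup>2 = ennreal (1 / (C * s powr Q)\<^sup>2)"
    using assms z C by (simp add: ennreal_power divide_ennreal flip: ennreal_1)
  also have "\<dots> = ennreal ((1 / (C * s powr Q))\<^sup>2)" by (simp add: power_divide)
  finally show ?thesis .
qed

text \<open>Only the constant bound times the indicator of \<open>A\<close> has to be measurable, so
  the density may remain an arbitrary function.\<close>

lemma emeasure_flat_le:
  assumes "A \<in> qborel X \<rho>" "A \<subseteq> Xc" "0 < s" "\<And>z. z \<in> A \<Longrightarrow> s \<le> \<rho> z c"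
  shows "emeasure \<mu>c A \<le> ennreal ((C / s powr Q)\<^sup>2) * emeasure M A"
proof -
  have "emeasure \<mu>c A \<le> (\<integral>\<^sup>+z. ennreal ((C / s powr Q)\<^sup>2) * indicator A z \<partial>M)"
    unfolding emeasure_flat[OF assms(1,2)]
  proof (rule nn_integral_mono)
    fix z
    show "flat_density z * indicator A z \<le> ennreal ((C / s powr Q)\<^sup>2) * indicator A z"
      using density_le[of z s] assms by (auto split: split_indicator)
  qed
  also have "\<dots> = ennreal ((C / s powr Q)\<^sup>2) * emeasure M A"
    using assms(1) qborel_sets by (intro nn_integral_cmult_indicator) auto
  finally show ?thesis .
qed

lemma emeasure_flat_ge:
  assumes "A \<in> qborel X \<rho>" "A \<subseteq> Xc" "\<And>z. z \<in> A \<Longrightarrow> \<rho> z c \<le> s"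
  shows "ennreal ((1 / (C * s powr Q))\<^sup>2) * emeasure M A \<le> emeasure \<mu>c A"
proof -
  have "ennreal ((1 / (C * s powr Q))\<^sup>2) * emeasure M A
      = (\<integral>\<^sup>+z. ennreal ((1 / (C * s powr Q))\<^sup>2) * indicator A z \<partial>M)"
    using assms(1) qborel_sets by (intro nn_integral_cmult_indicator[symmetric]) auto
  also have "\<dots> \<le> emeasure \<mu>c A"
    unfolding emeasure_flat[OF assms(1,2)]
  proof (rule nn_integral_mono)
    fix z
    show "ennreal ((1 / (C * s powr Q))\<^sup>2) * indicator A z \<le> flat_density z * indicator A z"
      using density_ge[of z s] assms by (auto split: split_indicator)
  qed
  finally show ?thesis .
qed

lemma open_qborel: "openin (qtopology X \<rho>) U \<Longrightarrow> U \<in> qborel X \<rho>"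
  by (simp add: qborel_def)

text \<open>An open \<open>V\<close> between the balls of radii \<open>r / K\<close> and
  \<open>r\<close> stands in for the ball. Its mass is at least \<open>(r / K) powr Q / C\<close>,
  and the density on it is at least \<open>(1 / (C * s powr Q))^2\<close>.\<close>

lemma outer_measure_flat_ge:
  assumes y: "y \<in> X" and r: "0 < r" "r \<le> D" and sub: "qball X \<rho> y r \<subseteq> A" "A \<subseteq> Xc"
    and s: "\<And>z. z \<in> qball X \<rho> y r \<Longrightarrow> \<rho> z c \<le> s"
  shows "ennreal ((1 / (C * s powr Q))\<^sup>2 * ((r / K) powr Q / C)) \<le> outer_measure_of \<mu>c A"
proof -
  have "r / K > 0" "r / K \<le> r" using r K by (auto simp: field_simps)
  then obtain V where V: "openin (qtopology X \<rho>) V" "qball X \<rho> y (r / K) \<subseteq> V"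
      "V \<subseteq> qball X \<rho> y (K * (r / K))"
    using qball_open_between[OF qm y] by metis
  have VA: "V \<subseteq> qball X \<rho> y r" using V(3) K by simp
  have VB: "V \<in> qborel X \<rho>" "V \<subseteq> Xc" using V(1) open_qborel VA sub by auto
  have "ennreal ((r / K) powr Q / C) \<le> outer_measure_of M (qball X \<rho> y (r / K))"
    using y \<open>r / K > 0\<close> \<open>r / K \<le> r\<close> r by (intro lower) auto
  also have "\<dots> \<le> outer_measure_of M V" using V(2) by (rule outer_measure_of_mono)
  also have "\<dots> = emeasure M V" using VB qborel_sets by auto
  finally have low: "ennreal ((r / K) powr Q / C) \<le> emeasure M V" .
  have "ennreal ((1 / (C * s powr Q))\<^sup>2 * ((r / K) powr Q / C))
      = ennreal ((1 / (C * s powr Q))\<^sup>2) * ennreal ((r / K) powr Q / C)"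
    using C by (intro ennreal_mult) auto
  also have "\<dots> \<le> ennreal ((1 / (C * s powr Q))\<^sup>2) * emeasure M V"
    using low by (rule mult_left_mono) simp
  also have "\<dots> \<le> emeasure \<mu>c V"
    using VB VA s by (intro emeasure_flat_ge) auto
  also have "\<dots> = outer_measure_of \<mu>c V" using VB by (simp add: sets_flat)
  also have "\<dots> \<le> outer_measure_of \<mu>c A" using VA sub by (intro outer_measure_of_mono) auto
  finally show ?thesis .
qed

text \<open>The Borel hull is \<open>V - W\<close>: an open \<open>V\<close> around the ball of
  radius \<open>r\<close>, without an open \<open>W\<close> around \<open>c\<close>. As
  \<open>W\<close> lies in the ball of radius \<open>s\<close>, nothing of \<open>A\<close> is lost;
  as it contains the ball of radius \<open>s / K\<close>, the density stays bounded on the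
  rest.\<close>

lemma flat_cover:
  assumes y: "y \<in> X" and rs: "0 < r" "0 < s" and A: "A \<subseteq> qball X \<rho> y r" "\<And>z. z \<in> A \<Longrightarrow> s \<le> \<rho> z c"
  obtains E where "E \<in> sets \<mu>c" "A \<subseteq> E"
    "emeasure \<mu>c E \<le> ennreal ((C / (s / K) powr Q)\<^sup>2 * (C * (K * r) powr Q))"
proof -
  have sK: "s / K > 0" using rs K by auto
  obtain V where V: "openin (qtopology X \<rho>) V" "qball X \<rho> y r \<subseteq> V" "V \<subseteq> qball X \<rho> y (K * r)"
    using qball_open_between[OF qm y rs(1)] by metis
  obtain W where W: "openin (qtopology X \<rho>) W" "qball X \<rho> c (s / K) \<subseteq> W"
      "W \<subseteq> qball X \<rho> c (K * (s / K))"
    using qball_open_between[OF qm c sK] by metis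
  interpret sigma_algebra X "qborel X \<rho>" by (rule sigma_algebra_qborel)
  have EB: "V - W \<in> qborel X \<rho>" using V(1) W(1) open_qborel by (intro Diff)
  have "c \<in> W" using W(2) c sK dist_eq_0[of c c] by (auto simp: qball_def)
  moreover have "V \<subseteq> X" using V(3) by (auto simp: qball_def)
  ultimately have EX: "V - W \<subseteq> Xc" by auto
  show ?thesis
  proof
    show "V - W \<in> sets \<mu>c" using EB EX by (simp add: sets_flat)
    show "A \<subseteq> V - W"
    proof
      fix z assume z: "z \<in> A"
      have "z \<in> X" using A(1) z by (auto simp: qball_def)
      then have "s \<le> \<rho> c z" using A(2)[OF z] c dist_sym[of z c] by simp
      then have "z \<notin> W" using W(3) K by (auto simp: qball_def)
      then show "z \<in> V - W" using z A V by auto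
    qed
    have "emeasure \<mu>c (V - W) \<le> ennreal ((C / (s / K) powr Q)\<^sup>2) * emeasure M (V - W)"
    proof (rule emeasure_flat_le[OF EB EX sK])
      fix z assume z: "z \<in> V - W"
      then have "z \<in> X" "\<not> \<rho> c z < s / K" using W(2) EX by (auto simp: qball_def)
      then show "s / K \<le> \<rho> z c" using dist_sym[of z c] c by auto
    qed
    also have "\<dots> \<le> ennreal ((C / (s / K) powr Q)\<^sup>2) * ennreal (C * (K * r) powr Q)"
    proof (rule mult_left_mono)
      have "emeasure M (V - W) = outer_measure_of M (V - W)" using EB qborel_sets by auto
      also have "\<dots> \<le> outer_measure_of M (qball X \<rho> y (K * r))"
        using V(3) by (intro outer_measure_of_mono) auto
      also have "\<dots> \<le> ennreal (C * (K * r) powr Q)" using y rs K by (intro upper) auto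
      finally show "emeasure M (V - W) \<le> ennreal (C * (K * r) powr Q)" .
    qed simp
    also have "\<dots> = ennreal ((C / (s / K) powr Q)\<^sup>2 * (C * (K * r) powr Q))"
      using C by (intro ennreal_mult[symmetric]) auto
    finally show "emeasure \<mu>c (V - W) \<le> ennreal ((C / (s / K) powr Q)\<^sup>2 * (C * (K * r) powr Q))" .
  qed
qed


section \<open>Lower mass bounds for flattened balls\<close>

abbreviation "flat_ball \<equiv> qball Xc \<rho>c"

text \<open>The smallness of \<open>R * \<rho> x c\<close> turns
  \<open>t = R * \<delta>^2 / K\<close> into an admissible radius for
  \<open>qball_subset_flat_ball\<close>. On that ball distances to \<open>c\<close> are at most
  \<open>K * \<delta>\<close>, and \<delta> cancels between mass and density.\<close>

lemma flat_ball_lower_near: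
  assumes x: "x \<in> Xc" and R: "R > 0" "R * \<rho> x c \<le> 1 / K"
  shows "ennreal ((R / K ^ 4) powr Q / C ^ 3) \<le> outer_measure_of \<mu>c (flat_ball x R)"
proof -
  define \<delta> where "\<delta> = \<rho> x c"
  define t where "t = R * \<delta>\<^sup>2 / K"
  have xX: "x \<in> X" and \<delta>: "0 < \<delta>" "\<delta> \<le> D"
    using x c dist_pos diam by (auto simp: \<delta>_def)
  have "R * \<delta> * \<delta> \<le> 1 / K * \<delta>" using R \<delta> by (intro mult_right_mono) (auto simp: \<delta>_def)
  then have "R * \<delta>\<^sup>2 \<le> \<delta> / K" by (simp add: power2_eq_square mult.assoc)
  also have "\<delta> / K \<le> \<delta>" using \<delta> K by (simp add: field_simps)
  finally have "R * \<delta>\<^sup>2 \<le> \<delta>" .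
  then have tK: "t \<le> \<delta> / K" using K by (simp add: t_def divide_right_mono)
  also have "\<delta> / K \<le> \<delta>" using \<delta> K by (simp add: field_simps)
  finally have t\<delta>: "t \<le> \<delta>" .
  have t0: "0 < t" using \<delta> R K by (simp add: t_def)
  have "ennreal ((1 / (C * (K * \<delta>) powr Q))\<^sup>2 * ((t / K) powr Q / C))
      \<le> outer_measure_of \<mu>c (flat_ball x R)"
  proof (rule outer_measure_flat_ge[OF xX t0])
    show "t \<le> D" using t\<delta> \<delta> by simp
    show "qball X \<rho> x t \<subseteq> flat_ball x R"
      using x R tK by (intro qball_subset_flat_ball) (auto simp: \<delta>_def t_def)
    show "flat_ball x R \<subseteq> Xc" by (auto simp: qball_def)
    fix z assume "z \<in> qball X \<rho> x t"
    then have z: "z \<in> X" "\<rho> z x < t" using dist_sym xX by (auto simp: qball_def)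
    have "\<rho> z c \<le> K * max (\<rho> z x) (\<rho> x c)" using dist_triangle z xX c by blast
    also have "\<dots> \<le> K * \<delta>" using z t\<delta> K by (intro mult_left_mono) (auto simp: \<delta>_def)
    finally show "\<rho> z c \<le> K * \<delta>" .
  qed
  also have "(1 / (C * (K * \<delta>) powr Q))\<^sup>2 * ((t / K) powr Q / C) = (R / K ^ 4) powr Q / C ^ 3"
    using \<delta> K C R
    by (simp add: t_def powr_mult powr_divide power2_eq_square power3_eq_cube power4_eq_xxxx field_simps)
  finally show ?thesis .
qed

text \<open>For small \<epsilon> the upper mass bound for the ball of radius \<epsilon> t is below the lower
  bound for the ball of radius t.\<close>

lemma ring_about_base:
  obtains \<epsilon> where "0 < \<epsilon>" "\<epsilon> \<le> 1"
    "\<And>t. \<lbrakk>0 < t; t \<le> D\<rbrakk> \<Longrightarrow> \<exists>y\<in>X. \<epsilon> * t \<le> \<rho> y c \<and> \<rho> y c < t"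
proof
  \<comment> \<open>Chosen so that \<epsilon>^Q = 1 / (1 + C^2). Then C (\<epsilon> t)^Q is strictly
    below t^Q / C, because C^2 < 1 + C^2.\<close>
  define \<epsilon> where "\<epsilon> = (1 / (1 + C\<^sup>2)) powr (1 / Q)"
  have pos: "1 + C\<^sup>2 > 0" by (simp add: add_pos_nonneg)
  show \<epsilon>0: "0 < \<epsilon>" using pos by (auto simp: \<epsilon>_def)
  show "\<epsilon> \<le> 1" unfolding \<epsilon>_def using Q pos by (intro powr_le1) (auto simp: abs_if field_simps)
  have \<epsilon>Q: "\<epsilon> powr Q = 1 / (1 + C\<^sup>2)" using Q pos by (simp add: \<epsilon>_def powr_powr)
  fix t assume t: "0 < t" "t \<le> D"
  show "\<exists>y\<in>X. \<epsilon> * t \<le> \<rho> y c \<and> \<rho> y c < t"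
  proof (rule ccontr)
    assume "\<not> ?thesis"
    then have "\<rho> c y < \<epsilon> * t" if "y \<in> X" "\<rho> c y < t" for y
      using that dist_sym[OF that(1) c] by force
    then have "qball X \<rho> c t \<subseteq> qball X \<rho> c (\<epsilon> * t)" by (auto simp: qball_def)
    then have "outer_measure_of M (qball X \<rho> c t) \<le> outer_measure_of M (qball X \<rho> c (\<epsilon> * t))"
      by (rule outer_measure_of_mono)
    then have "ennreal (t powr Q / C) \<le> ennreal (C * (\<epsilon> * t) powr Q)"
      using lower[OF c t] upper[OF c, of "\<epsilon> * t"] t \<epsilon>0 by (auto intro: order_trans)
    then have "t powr Q / C \<le> C * (\<epsilon> * t) powr Q"
      using C by simp
    then have "t powr Q / C \<le> C * t powr Q / (1 + C\<^sup>2)" by (simp add: powr_mult \<epsilon>Q)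
    then have "t powr Q * (1 + C\<^sup>2) \<le> C * t powr Q * C"
      using C pos by (simp add: pos_divide_le_eq pos_le_divide_eq)
    then show False using t by (simp add: algebra_simps power2_eq_square)
  qed
qed

text \<open>A point z of the small ball about y has distance at most K^2 \<delta> from x and at
  least \<tau> from c, so \<open>\<rho>c x z\<close> is at most K^2 / \<tau>. The value of
  \<open>L\<close> gives \<tau> = 2 K^2 / R, and the factor 2 makes the resulting bound R / 2
  strictly smaller than R.\<close>

lemma flat_ball_lower_far:
  assumes x: "x \<in> Xc" and R: "R > 0" and \<epsilon>: "0 < \<epsilon>" "\<epsilon> \<le> 1"
    and L: "L = 2 * K ^ 3 / \<epsilon>" "L < R * \<rho> x c"
    and y: "y \<in> X" "\<epsilon> * (L / R) \<le> \<rho> y c" "\<rho> y c < L / R"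
  shows "ennreal ((R * \<epsilon> / (L * K ^ 4)) powr Q / C ^ 3) \<le> outer_measure_of \<mu>c (flat_ball x R)"
proof -
  define \<delta> where "\<delta> = \<rho> x c"
  define t where "t = L / R"
  \<comment> \<open>Division by \<open>K\<close> makes \<tau> at most \<open>\<rho> y c / K\<close>,
    so that \<open>far_from_base\<close> at \<open>y\<close> keeps the whole ball of radius \<tau>
    at distance at least \<tau> from \<open>c\<close>.\<close>
  define \<tau> where "\<tau> = \<epsilon> * t / K"
  have xX: "x \<in> X" and \<delta>: "0 < \<delta>" "\<delta> \<le> D"
    using x c dist_pos diam by (auto simp: \<delta>_def)
  have L0: "0 < L" using L K \<epsilon> by auto
  have t: "0 < t" "t < \<delta>" using L0 L(2) R by (auto simp: t_def \<delta>_def pos_divide_less_eq mult.commute)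
  have "\<epsilon> * t \<le> t" using \<epsilon> t by (simp add: mult_le_cancel_right1)
  moreover have "\<tau> \<le> \<epsilon> * t" using \<epsilon> t K by (simp add: \<tau>_def field_simps)
  ultimately have "\<tau> \<le> t" by (rule order_trans[rotated])
  moreover have "0 < \<tau>" using \<epsilon> t K by (simp add: \<tau>_def)
  ultimately have \<tau>: "0 < \<tau>" "\<tau> \<le> t" by auto
  have near: "z \<in> X" "\<rho> z c \<le> K * t" "\<tau> \<le> \<rho> z c" if "z \<in> qball X \<rho> y \<tau>" for z
  proof -
    from that show z: "z \<in> X" by (simp add: qball_def)
    have yz: "\<rho> y z < \<tau>" using that by (simp add: qball_def)
    have "\<rho> z c \<le> K * max (\<rho> z y) (\<rho> y c)" using dist_triangle z y c by blast
    also have "\<dots> \<le> K * t"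
      using yz \<tau> y K dist_sym[OF z y(1)] by (intro mult_left_mono) (auto simp: t_def)
    finally show "\<rho> z c \<le> K * t" .
    have "\<tau> \<le> \<rho> y c / K" 
      unfolding \<tau>_def t_def using y K by (intro divide_right_mono) auto
    then show "\<tau> \<le> \<rho> z c" using far_from_base[OF y(1) z] yz by simp
  qed
  have "ennreal ((1 / (C * (K * t) powr Q))\<^sup>2 * ((\<tau> / K) powr Q / C))
      \<le> outer_measure_of \<mu>c (flat_ball x R)"
  proof (rule outer_measure_flat_ge[OF y(1) \<tau>(1)])
    show "\<tau> \<le> D" using \<tau> t \<delta> by simp
    show "flat_ball x R \<subseteq> Xc" by (auto simp: qball_def)
    show "qball X \<rho> y \<tau> \<subseteq> flat_ball x R"
    proof
      fix z assume z: "z \<in> qball X \<rho> y \<tau>"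
      note z = near[OF z]
      have zc: "0 < \<rho> z c" using z \<tau> by simp
      have "\<rho> x z \<le> K * max (\<rho> x c) (\<rho> c z)" using dist_triangle xX z c by blast
      also have "\<dots> \<le> K * (K * \<delta>)"
      proof (intro mult_left_mono max.boundedI)
        show "\<rho> x c \<le> K * \<delta>" using K \<delta> by (simp add: \<delta>_def mult_le_cancel_right1)
        have "K * t \<le> K * \<delta>" using K t by simp
        then show "\<rho> c z \<le> K * \<delta>" using z dist_sym[OF z(1) c] by simp
      qed (use K in auto)
      finally have xz: "\<rho> x z \<le> K\<^sup>2 * \<delta>" by (simp add: power2_eq_square mult.assoc)
      have "K\<^sup>2 * \<delta> < R * \<delta> * \<tau>"
        using \<delta> K R \<epsilon> by (simp add: \<tau>_def t_def L power2_eq_square power3_eq_cube)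
      also have "\<dots> \<le> R * \<delta> * \<rho> z c" using z R \<delta> by (intro mult_left_mono) auto
      finally have "\<rho> x z < R * (\<delta> * \<rho> z c)" using xz by (simp add: mult.assoc)
      then have "\<rho>c x z < R" using \<delta> zc by (simp add: flat_dist_def \<delta>_def pos_divide_less_eq)
      moreover have "z \<noteq> c" using zc dist_eq_0[of c c] c by auto
      ultimately show "z \<in> flat_ball x R" using z by (simp add: qball_def)
    qed
    show "\<And>z. z \<in> qball X \<rho> y \<tau> \<Longrightarrow> \<rho> z c \<le> K * t" using near by blast
  qed
  also have "(1 / (C * (K * t) powr Q))\<^sup>2 * ((\<tau> / K) powr Q / C) = (R * \<epsilon> / (L * K ^ 4)) powr Q / C ^ 3"
    using \<epsilon> K C R L0
    by (simp add: \<tau>_def t_def powr_mult powr_divide power2_eq_square power3_eq_cube power4_eq_xxxx field_simps)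
  finally show ?thesis .
qed

text \<open>If \<open>R * \<rho> x c\<close> exceeds \<open>L\<close>, then \<open>L / R\<close> is
  at most \<open>D\<close> and the ring about \<open>c\<close> at that scale supplies the point
  \<open>y\<close>. Below \<open>L\<close>, including the middle range between \<open>1 / K\<close>
  and \<open>L\<close>, the radius is shrunk until the near case applies.\<close>

lemma flat_ball_lower:
  obtains b where "b > 0"
    "\<And>x R. \<lbrakk>x \<in> Xc; R > 0\<rbrakk> \<Longrightarrow> ennreal (b * R powr Q) \<le> outer_measure_of \<mu>c (flat_ball x R)"
proof -
  obtain \<epsilon> where \<epsilon>: "0 < \<epsilon>" "\<epsilon> \<le> 1"
    and ring: "\<And>t. \<lbrakk>0 < t; t \<le> D\<rbrakk> \<Longrightarrow> \<exists>y\<in>X. \<epsilon> * t \<le> \<rho> y c \<and> \<rho> y c < t"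
    using ring_about_base by blast
  define L where "L = 2 * K ^ 3 / \<epsilon>"
  define b where "b = min ((1 / (K * L * K ^ 4)) powr Q / C ^ 3) ((\<epsilon> / (L * K ^ 4)) powr Q / C ^ 3)"
  have "1 \<le> K ^ 3" using K by simp
  then have L1: "1 \<le> L" unfolding L_def using \<epsilon> by (simp add: field_simps)
  have "b > 0" using L1 \<epsilon> K C by (auto simp: b_def)
  moreover have "ennreal (b * R powr Q) \<le> outer_measure_of \<mu>c (flat_ball x R)"
    if x: "x \<in> Xc" and R: "R > 0" for x R
  proof (cases "R * \<rho> x c \<le> L")
    case True
    \<comment> \<open>Shrinking by the fixed factor \<open>K * L\<close> costs only a constant and
      lowers \<open>R * \<rho> x c\<close> from at most \<open>L\<close> to at most
      \<open>1 / K\<close>.\<close>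
    let ?R = "R / (K * L)"
    have "1 * 1 \<le> K * L" using K L1 by (intro mult_mono) auto
    then have R': "0 < ?R" "?R \<le> R" using R by (auto simp: field_simps)
    have "?R * \<rho> x c = R * \<rho> x c / L / K" by simp
    also have "\<dots> \<le> 1 / K" using True L1 K by (intro divide_right_mono) auto
    finally have near: "?R * \<rho> x c \<le> 1 / K" .
    have "b * R powr Q \<le> (1 / (K * L * K ^ 4)) powr Q / C ^ 3 * R powr Q"
      by (intro mult_right_mono) (auto simp: b_def)
    also have "\<dots> = (?R / K ^ 4) powr Q / C ^ 3"
      by (simp add: powr_mult powr_divide)
    finally have "ennreal (b * R powr Q) \<le> ennreal ((?R / K ^ 4) powr Q / C ^ 3)"
      by (rule ennreal_leI)
    also have "\<dots> \<le> outer_measure_of \<mu>c (flat_ball x ?R)"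
      by (rule flat_ball_lower_near[OF x R'(1) near])
    also have "\<dots> \<le> outer_measure_of \<mu>c (flat_ball x R)"
      using R' by (intro outer_measure_of_mono) (auto simp: qball_def)
    finally show ?thesis .
  next
    case False
    have "\<rho> x c \<le> D" using x c diam by auto
    then have "R * \<rho> x c \<le> R * D" using R by simp
    then have "L \<le> R * D" using False by linarith
    then have "0 < L / R" "L / R \<le> D" using R L1 by (auto simp: pos_divide_le_eq mult.commute)
    then obtain y where y: "y \<in> X" "\<epsilon> * (L / R) \<le> \<rho> y c" "\<rho> y c < L / R"
      using ring by blast
    have "b * R powr Q \<le> (\<epsilon> / (L * K ^ 4)) powr Q / C ^ 3 * R powr Q"
      by (intro mult_right_mono) (auto simp: b_def)
    also have "\<dots> = (R * \<epsilon> / (L * K ^ 4)) powr Q / C ^ 3"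
      by (simp add: powr_mult powr_divide)
    finally have "ennreal (b * R powr Q) \<le> ennreal ((R * \<epsilon> / (L * K ^ 4)) powr Q / C ^ 3)"
      by (rule ennreal_leI)
    also have "\<dots> \<le> outer_measure_of \<mu>c (flat_ball x R)"
      using flat_ball_lower_far[OF x R \<epsilon> L_def _ y] False by simp
    finally show ?thesis .
  qed
  ultimately show ?thesis by (rule that)
qed

section \<open>Upper mass bounds for flattened balls\<close>

text \<open>Smallness of \<open>R * \<rho> x c\<close> gives
  \<open>K * \<rho> x y < \<rho> y c\<close>, so in the triangle inequality for
  \<open>\<rho> y c\<close> the term \<open>\<rho> y x\<close> cannot be the maximum and
  \<open>\<rho> y c \<le> K * \<delta>\<close>. Inserted into \<rho>(x,y) < R \<delta> \<rho>(y,c),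
  this confines the flattened ball to radius K R \<delta>^2.\<close>

lemma flat_ball_upper_near:
  assumes x: "x \<in> Xc" and R: "R > 0" "R * \<rho> x c \<le> 1 / K"
  shows "outer_measure_of \<mu>c (flat_ball x R) \<le> ennreal (C ^ 3 * (K ^ 6 * R) powr Q)"
proof -
  define \<delta> where "\<delta> = \<rho> x c"
  have xX: "x \<in> X" and \<delta>: "0 < \<delta>"
    using x c dist_pos by (auto simp: \<delta>_def)
  have ball: "y \<in> X \<and> \<rho> x y < K * R * \<delta>\<^sup>2 \<and> \<delta> / K \<le> \<rho> y c" if "y \<in> flat_ball x R" for y
  proof -
    have y: "y \<in> X" "y \<noteq> c" "\<rho>c x y < R" using that by (auto simp: qball_def)
    have yc: "0 < \<rho> y c" using y c dist_pos by auto
    have xy: "\<rho> x y < R * \<delta> * \<rho> y c"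
      using y yc \<delta> by (simp add: flat_dist_def \<delta>_def pos_divide_less_eq mult.assoc)
    also have "\<dots> \<le> 1 / K * \<rho> y c" using R yc by (intro mult_right_mono) (auto simp: \<delta>_def)
    finally have xyK: "K * \<rho> x y < \<rho> y c" using K by (simp add: field_simps)
    have "\<rho> y c \<le> K * max (\<rho> y x) (\<rho> x c)" using dist_triangle y xX c by blast
    then have ycK: "\<rho> y c \<le> K * \<delta>"
      using xyK dist_sym[OF y(1) xX] by (simp add: \<delta>_def max_def split: if_splits)
    have "\<rho> x c \<le> K * max (\<rho> x y) (\<rho> y c)" using dist_triangle y xX c by blast
    also have "\<dots> \<le> K * \<rho> y c"
    proof (intro mult_left_mono max.boundedI)
      have "\<rho> x y \<le> K * \<rho> x y" using K dist_nonneg[OF xX y(1)] by (simp add: mult_le_cancel_right1)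
      then show "\<rho> x y \<le> \<rho> y c" using xyK by simp
    qed (use K in auto)
    finally have "\<delta> / K \<le> \<rho> y c" using K by (simp add: \<delta>_def field_simps)
    moreover have "R * \<delta> * \<rho> y c \<le> R * \<delta> * (K * \<delta>)" using ycK R \<delta> by (intro mult_left_mono) auto
    then have "\<rho> x y < K * R * \<delta>\<^sup>2" using xy by (simp add: power2_eq_square algebra_simps)
    ultimately show ?thesis using y by simp
  qed
  have r: "0 < K * R * \<delta>\<^sup>2" "0 < \<delta> / K" using K R \<delta> by auto
  have "flat_ball x R \<subseteq> qball X \<rho> x (K * R * \<delta>\<^sup>2)"
    using ball by (auto simp: qball_def[of X])
  then obtain E where E: "E \<in> sets \<mu>c" "flat_ball x R \<subseteq> E"
      "emeasure \<mu>c E \<le> ennreal ((C / (\<delta> / K / K) powr Q)\<^sup>2 * (C * (K * (K * R * \<delta>\<^sup>2)) powr Q))"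
    using flat_cover[OF xX r] ball by metis
  have "outer_measure_of \<mu>c (flat_ball x R) \<le> outer_measure_of \<mu>c E"
    using E(2) by (rule outer_measure_of_mono)
  also have "\<dots> = emeasure \<mu>c E" using E(1) by simp
  also note E(3)
  also have "(C / (\<delta> / K / K) powr Q)\<^sup>2 * (C * (K * (K * R * \<delta>\<^sup>2)) powr Q) = C ^ 3 * (K ^ 6 * R) powr Q"
    using \<delta> K C R
    by (simp add: powr_mult powr_divide power2_eq_square eval_nat_numeral field_simps)
  finally show ?thesis .
qed

text \<open>On the ring at distance about 2^n s the mass is of order (2^n s)^Q and the density of
  order (2^n s)^(-2Q). The ring masses are thus dominated by a geometric series with ratio
  \<open>q = (1 / 2) powr Q\<close>, which is below 1 because Q > 0.\<close>

lemma outside_base_upper: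
  assumes s: "s > 0" and A: "A \<subseteq> X" "\<And>z. z \<in> A \<Longrightarrow> s \<le> \<rho> z c"
  shows "outer_measure_of \<mu>c A \<le> ennreal (C ^ 3 * (2 * K ^ 3 / s) powr Q / (1 - (1 / 2) powr Q))"
proof -
  define q :: real where "q = (1 / 2) powr Q"
  have q: "0 \<le> q" "q < 1" using Q powr_less_mono2[of Q "1/2" 1] by (auto simp: q_def)
  define B where "B = C ^ 3 * (2 * K ^ 3 / s) powr Q"
  have "\<exists>E. E \<in> sets \<mu>c \<and> {z \<in> A. 2 ^ n * s \<le> \<rho> z c \<and> \<rho> z c < 2 ^ Suc n * s} \<subseteq> E
      \<and> emeasure \<mu>c E \<le> ennreal (B * q ^ n)" for n :: nat
  proof -
    let ?A = "{z \<in> A. 2 ^ n * s \<le> \<rho> z c \<and> \<rho> z c < 2 ^ Suc n * s}"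
    have r: "0 < 2 ^ Suc n * s" "0 < 2 ^ n * s" using s by auto
    have sub: "?A \<subseteq> qball X \<rho> c (2 ^ Suc n * s)"
    proof
      fix z assume z: "z \<in> ?A"
      then have "z \<in> X" using A by auto
      then show "z \<in> qball X \<rho> c (2 ^ Suc n * s)" using z dist_sym[of z c] c by (simp add: qball_def)
    qed
    obtain E where E: "E \<in> sets \<mu>c" "?A \<subseteq> E"
      "emeasure \<mu>c E \<le> ennreal ((C / (2 ^ n * s / K) powr Q)\<^sup>2 * (C * (K * (2 ^ Suc n * s)) powr Q))"
      using flat_cover[OF c r sub] by auto
    define p where "p = (2 ^ n :: real) powr Q"
    have "p > 0" by (simp add: p_def)
    have "q ^ n = 1 / p"
      by (simp add: q_def p_def powr_divide power_divide powr_power powr_powr mult.commute flip: powr_realpow)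
    moreover have "(C / (2 ^ n * s / K) powr Q)\<^sup>2 * (C * (K * (2 ^ Suc n * s)) powr Q) = B * (1 / p)"
      using s K C \<open>p > 0\<close>
      by (simp add: B_def powr_mult powr_divide p_def[symmetric] power2_eq_square power3_eq_cube field_simps)
    ultimately show ?thesis using E by auto
  qed
  then have "\<forall>n. \<exists>E. E \<in> sets \<mu>c \<and> {z \<in> A. 2 ^ n * s \<le> \<rho> z c \<and> \<rho> z c < 2 ^ Suc n * s} \<subseteq> E
      \<and> emeasure \<mu>c E \<le> ennreal (B * q ^ n)" ..
  from choice[OF this] obtain E where E: "\<And>n. E n \<in> sets \<mu>c"
      "\<And>n. {z \<in> A. 2 ^ n * s \<le> \<rho> z c \<and> \<rho> z c < 2 ^ Suc n * s} \<subseteq> E n"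
      "\<And>n. emeasure \<mu>c (E n) \<le> ennreal (B * q ^ n)"
    by blast
  have "A \<subseteq> (\<Union>n. E n)"
  proof
    fix z assume z: "z \<in> A"
    obtain N where "\<rho> z c / s < 2 ^ N" using real_arch_pow[of 2 "\<rho> z c / s"] by auto
    then have "\<rho> z c < 2 ^ N * s" using s by (simp add: field_simps)
    moreover have "\<not> \<rho> z c < 2 ^ 0 * s" using A(2)[OF z] by simp
    ultimately obtain n where n: "\<forall>i\<le>n. \<not> \<rho> z c < 2 ^ i * s" "\<rho> z c < 2 ^ Suc n * s"
      using ex_least_nat_less[of "\<lambda>n. \<rho> z c < 2 ^ n * s"] by blast
    then have "2 ^ n * s \<le> \<rho> z c" using not_less by blast
    then have "z \<in> E n" using E(2)[of n] n(2) z by blast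
    then show "z \<in> (\<Union>n. E n)" by blast
  qed
  then have "outer_measure_of \<mu>c A \<le> outer_measure_of \<mu>c (\<Union>n. E n)"
    by (rule outer_measure_of_mono)
  also have "\<dots> = emeasure \<mu>c (\<Union>n. E n)" using E(1) by (intro outer_measure_of_eq) auto
  also have "\<dots> \<le> (\<Sum>n. emeasure \<mu>c (E n))"
    using E(1) by (intro emeasure_subadditive_countably) auto
  also have "\<dots> \<le> (\<Sum>n. ennreal (B * q ^ n))" using E(3) by (intro suminf_le) auto
  also have "\<dots> = ennreal (B * (1 / (1 - q)))"
  proof (rule suminf_ennreal_eq)
    show "0 \<le> B * q ^ n" for n using q C by (simp add: B_def)
    show "(\<lambda>n. B * q ^ n) sums (B * (1 / (1 - q)))" using q by (intro sums_mult geometric_sums) auto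
  qed
  finally show ?thesis by (simp add: B_def q_def)
qed

text \<open>When \<open>R * \<rho> x c\<close> exceeds \<open>1 / K\<close>, a flattened ball stays
  away from \<open>c\<close>: a point close to \<open>x\<close> does so by
  \<open>far_from_base\<close>, and for any other point a small \<open>\<rho> y c\<close> would push
  \<open>\<rho>c x y\<close> up to \<open>R\<close>. Then \<open>outside_base_upper\<close>
  applies.\<close>

lemma flat_ball_upper:
  obtains b where "b > 0"
    "\<And>x R. \<lbrakk>x \<in> Xc; R > 0\<rbrakk> \<Longrightarrow> outer_measure_of \<mu>c (flat_ball x R) \<le> ennreal (b * R powr Q)"
proof -
  define b1 where "b1 = C ^ 3 * (K ^ 6) powr Q"
  define b2 where "b2 = C ^ 3 * (2 * K ^ 5) powr Q / (1 - (1 / 2) powr Q)"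
  have q: "(1 / 2) powr Q < (1 :: real)" using Q powr_less_mono2[of Q "1/2" 1] by auto
  have b1: "b1 > 0" using C K by (simp add: b1_def)
  have b2: "b2 > 0" using C K q by (simp add: b2_def)
  have "outer_measure_of \<mu>c (flat_ball x R) \<le> ennreal ((b1 + b2) * R powr Q)"
    if x: "x \<in> Xc" and R: "R > 0" for x R
  proof (cases "R * \<rho> x c \<le> 1 / K")
    case True
    have "C ^ 3 * (K ^ 6 * R) powr Q = b1 * R powr Q" by (simp add: b1_def powr_mult)
    also have "\<dots> \<le> (b1 + b2) * R powr Q" using b2 by (intro mult_right_mono) auto
    finally have "ennreal (C ^ 3 * (K ^ 6 * R) powr Q) \<le> ennreal ((b1 + b2) * R powr Q)"
      by (rule ennreal_leI)
    with flat_ball_upper_near[OF x R True] show ?thesis by (rule order_trans)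
  next
    case False
    define \<delta> where "\<delta> = \<rho> x c"
    have xX: "x \<in> X" and \<delta>: "0 < \<delta>" using x c dist_pos by (auto simp: \<delta>_def)
    have R\<delta>: "1 / K < R * \<delta>" using False by (simp add: \<delta>_def)
    \<comment> \<open>This is \<open>\<delta> / K\<close> at the threshold
      \<open>R * \<delta> = 1 / K\<close>. Points not close to \<open>x\<close> satisfy the stronger
      bound \<open>1 / (K * R)\<close>.\<close>
    define s where "s = 1 / (K\<^sup>2 * R)"
    have s: "s > 0" using K R by (simp add: s_def)
    have far: "s \<le> \<rho> y c" if "y \<in> flat_ball x R" for y
    proof (cases "\<rho> x y < \<delta> / K")
      case True
      have "y \<in> X" using that by (simp add: qball_def)
      then have "\<delta> / K \<le> \<rho> y c" using far_from_base[OF xX] True by (simp add: \<delta>_def)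
      moreover have "s \<le> \<delta> / K"
        using R\<delta> K R by (simp add: s_def field_simps power2_eq_square)
      ultimately show ?thesis by simp
    next
      case False
      have y: "y \<in> X" "y \<noteq> c" "\<rho>c x y < R" using that by (auto simp: qball_def)
      have yc: "0 < \<rho> y c" using y c dist_pos by auto
      have "\<rho> x y < R * \<delta> * \<rho> y c"
        using y yc \<delta> by (simp add: flat_dist_def \<delta>_def pos_divide_less_eq mult.assoc)
      with False have "\<delta> / K < \<delta> * (R * \<rho> y c)" by (simp add: mult.left_commute)
      then have "1 / K < R * \<rho> y c" using \<delta> by (simp add: divide_inverse)
      moreover have "1 / (K\<^sup>2) \<le> 1 / K" using K by (simp add: power2_eq_square field_simps)
      ultimately have "1 / K\<^sup>2 \<le> R * \<rho> y c" by simp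
      then show ?thesis using R K by (simp add: s_def field_simps)
    qed
    have "2 * K ^ 3 / s = 2 * K ^ 5 * R"
      using K R by (simp add: s_def eval_nat_numeral)
    then have "C ^ 3 * (2 * K ^ 3 / s) powr Q / (1 - (1 / 2) powr Q) = b2 * R powr Q"
      by (simp add: b2_def powr_mult)
    also have "\<dots> \<le> (b1 + b2) * R powr Q" using b1 by (intro mult_right_mono) auto
    finally have le: "ennreal (C ^ 3 * (2 * K ^ 3 / s) powr Q / (1 - (1 / 2) powr Q))
        \<le> ennreal ((b1 + b2) * R powr Q)"
      by (rule ennreal_leI)
    have "flat_ball x R \<subseteq> X" by (auto simp: qball_def)
    from order_trans[OF outside_base_upper[OF s this far] le] show ?thesis .
  qed
  then show ?thesis using b1 b2 by (intro that[of "b1 + b2"]) auto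
qed

section \<open>Unboundedness, regularity and support of the flattening\<close>

text \<open>Points \<open>y\<close> other than \<open>c\<close> exist arbitrarily close to
  \<open>c\<close>. With \<open>w\<close> fixed and \<open>y\<close> tending to \<open>c\<close>,
  \<open>\<rho> w y\<close> stays above \<open>\<delta> / K\<close>, so \<open>\<rho>c w y\<close>
  is at least \<open>1 / (K * \<rho> y c)\<close> and tends to infinity.\<close>

lemma flat_unbounded: "qdiam Xc \<rho>c = \<infinity>"
proof (rule ccontr)
  obtain \<epsilon> where \<epsilon>: "0 < \<epsilon>"
    and ring: "\<And>t. \<lbrakk>0 < t; t \<le> D\<rbrakk> \<Longrightarrow> \<exists>y\<in>X. \<epsilon> * t \<le> \<rho> y c \<and> \<rho> y c < t"
    using ring_about_base by blast
  have near: "\<exists>y\<in>Xc. \<rho> y c < t" if "0 < t" for t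
  proof -
    obtain y where y: "y \<in> X" "\<epsilon> * min t D \<le> \<rho> y c" "\<rho> y c < min t D"
      using ring[of "min t D"] D \<open>0 < t\<close> by (meson min.cobounded2 min_less_iff_conj)
    moreover have "0 < \<epsilon> * min t D" using \<epsilon> D that by simp
    ultimately have "y \<noteq> c" using dist_eq_0[of c c] c by auto
    then show ?thesis using y by auto
  qed
  assume "qdiam Xc \<rho>c \<noteq> \<infinity>"
  then obtain B where B: "0 \<le> B" "qdiam Xc \<rho>c = ennreal B"
    by (cases "qdiam Xc \<rho>c") auto
  obtain w where w: "w \<in> Xc" using near[of 1] by auto
  define \<delta> where "\<delta> = \<rho> w c"
  have wX: "w \<in> X" and \<delta>: "0 < \<delta>" using w c dist_pos by (auto simp: \<delta>_def)
  \<comment> \<open>The first term keeps \<open>\<rho> w y\<close> comparable to \<delta>; the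
    second forces the flattened distance above \<open>B + 1\<close>.\<close>
  define t where "t = min (\<delta> / K) (1 / (K * (B + 1)))"
  have "0 < t" using \<delta> K B by (simp add: t_def)
  then obtain y where y: "y \<in> Xc" "\<rho> y c < t" using near by blast
  have yc: "0 < \<rho> y c" using y c dist_pos by auto
  have "\<delta> \<le> K * max (\<rho> w y) (\<rho> y c)" using dist_triangle[of w y c] wX y c by (simp add: \<delta>_def)
  moreover have "K * \<rho> y c < \<delta>" using y K by (simp add: t_def field_simps)
  ultimately have wy: "\<delta> \<le> K * \<rho> w y" by (simp add: max_def split: if_splits)
  have "\<rho> y c < 1 / (K * (B + 1))" using y by (simp add: t_def)
  moreover have "0 < K * (B + 1)" using K B by simp
  ultimately have "\<rho> y c * (K * (B + 1)) < 1" by (simp only: pos_less_divide_eq)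
  then have "K * ((B + 1) * \<rho> y c) < 1" by (simp only: ac_simps)
  then have "\<delta> * (K * ((B + 1) * \<rho> y c)) < \<delta> * 1" using \<delta> by (intro mult_strict_left_mono)
  with wy have "K * (\<delta> * (B + 1) * \<rho> y c) < K * \<rho> w y" by (simp add: algebra_simps)
  then have "\<delta> * (B + 1) * \<rho> y c < \<rho> w y" using K by simp
  then have "B + 1 < \<rho>c w y"
    using \<delta> yc by (simp add: flat_dist_def \<delta>_def[symmetric] pos_less_divide_eq algebra_simps)
  then have "ennreal B < ennreal (\<rho>c w y)" using B by (simp add: ennreal_less_iff)
  also have "\<dots> \<le> qdiam Xc \<rho>c"
    using w y by (intro le_qdiam)
  finally show False using B by simp
qed

lemma flat_ahlfors: "ahlfors_regular Q Xc \<rho>c \<mu>c"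
proof -
  obtain a where a: "a > 0"
    "\<And>x R. \<lbrakk>x \<in> Xc; R > 0\<rbrakk> \<Longrightarrow> ennreal (a * R powr Q) \<le> outer_measure_of \<mu>c (flat_ball x R)"
    using flat_ball_lower by blast
  obtain b where b: "b > 0"
    "\<And>x R. \<lbrakk>x \<in> Xc; R > 0\<rbrakk> \<Longrightarrow> outer_measure_of \<mu>c (flat_ball x R) \<le> ennreal (b * R powr Q)"
    using flat_ball_upper by blast
  define C' where "C' = max 1 (max (1 / a) b)"
  have C': "C' \<ge> 1" "1 / a \<le> C'" "b \<le> C'" by (auto simp: C'_def)
  have "inverse C' \<le> a" using C' a by (simp add: field_simps)
  show ?thesis
    unfolding ahlfors_regular_def
  proof (intro exI conjI ballI allI impI)
    fix x R assume x: "x \<in> Xc" and R: "R > (0 :: real)"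
    have "ennreal (inverse C' * R powr Q) \<le> ennreal (a * R powr Q)"
      using \<open>inverse C' \<le> a\<close> by (intro ennreal_leI mult_right_mono) auto
    with a(2)[OF x R] show "ennreal (inverse C' * R powr Q) \<le> outer_measure_of \<mu>c (flat_ball x R)"
      by (meson order_trans)
    have "ennreal (b * R powr Q) \<le> ennreal (C' * R powr Q)"
      using C' by (intro ennreal_leI mult_right_mono) auto
    with b(2)[OF x R] show "outer_measure_of \<mu>c (flat_ball x R) \<le> ennreal (C' * R powr Q)"
      by (rule order_trans)
  qed (fact C')
qed

text \<open>An open set of the flattening contains a ball of the original quasi-metric, and the
  density is bounded below on all of \<open>Xc\<close> since \<open>\<rho> z c \<le> D\<close>.
  Hence the support is the whole space, not merely dense.\<close>

lemma flat_support: "qsupport Xc \<rho>c \<mu>c = Xc"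
proof -
  have "0 < emeasure \<mu>c U" if U: "openin (qtopology Xc \<rho>c) U" "x \<in> U" for U x
  proof -
    have oU: "openin (qtopology X \<rho>) U" "U \<subseteq> Xc" using U by (auto simp: openin_flat)
    then obtain r where r: "0 < r" "qball X \<rho> x r \<subseteq> U"
      using U(2) by (auto simp: openin_qtopology)
    have x: "x \<in> X" using oU U by auto
    have "(0::ennreal) < ennreal ((1 / (C * D powr Q))\<^sup>2 * ((min r D / K) powr Q / C))"
      using C D K r by (simp add: ennreal_less_zero_iff)
    also have "\<dots> \<le> outer_measure_of \<mu>c U"
    proof (rule outer_measure_flat_ge[OF x])
      show "qball X \<rho> x (min r D) \<subseteq> U" using r by (auto simp: qball_def)
      show "\<rho> z c \<le> D" if "z \<in> qball X \<rho> x (min r D)" for z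
        using that diam c by (auto simp: qball_def)
    qed (use r D oU in auto)
    also have "\<dots> = emeasure \<mu>c U"
      using oU open_qborel by (intro outer_measure_of_eq) (auto simp: sets_flat)
    finally show ?thesis .
  qed
  then show ?thesis by (auto simp: qsupport_def)
qed

lemma flat_measure_space: "quasi_metric_measure_space (K\<^sup>2) Xc \<rho>c \<mu>c"
  unfolding quasi_metric_measure_space_def
proof (intro conjI ballI allI impI)
  show "qborel Xc \<rho>c \<subseteq> sets \<mu>c" by (simp add: sets_flat qborel_flat)
  \<comment> \<open>The measurable sets of \<open>\<mu>c\<close> are exactly the Borel sets of
    \<open>Xc\<close>, so \<open>A\<close> is its own Borel hull.\<close>
  show "\<exists>B\<in>qborel Xc \<rho>c. A \<subseteq> B \<and> emeasure \<mu>c B = emeasure \<mu>c A" if "A \<in> sets \<mu>c" for A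
    using that by (auto simp: sets_flat qborel_flat)
  show "qtopology Xc \<rho>c closure_of qsupport Xc \<rho>c \<mu>c = Xc"
    using closure_of_topspace[of "qtopology Xc \<rho>c"] by (simp add: flat_support topspace_qtopology)
  show "outer_measure_of \<mu>c (flat_ball x r) < \<infinity>" if "x \<in> Xc" "r > 0" for x r
  proof -
    obtain b where "\<And>x R. \<lbrakk>x \<in> Xc; R > 0\<rbrakk>
        \<Longrightarrow> outer_measure_of \<mu>c (flat_ball x R) \<le> ennreal (b * R powr Q)"
      using flat_ball_upper by blast
    from this[OF that] have "outer_measure_of \<mu>c (flat_ball x r) \<le> ennreal (b * r powr Q)" .
    then show ?thesis by (auto intro: le_less_trans)
  qed
qed (fact flat_quasi_metric space_flat)+

end

section \<open>Extending the regularity bounds to all required radii\<close>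

theorem theorem3p2:
  fixes X :: "'a set" and \<rho> :: "'a \<Rightarrow> 'a \<Rightarrow> real" and M :: "'a measure"
    and c :: 'a and K Q :: real
  assumes "Q > 0" and "K \<ge> 1"
    and "quasi_metric_measure_space K X \<rho> M"
    and "qbounded X \<rho>"
    and "ahlfors_regular Q X \<rho> M"
    and "c \<in> X" and "X \<noteq> {c}"
  shows "quasi_metric_measure_space (K\<^sup>2) (X - {c}) (flat_dist \<rho> c) (flat_measure X \<rho> M c)
    \<and> \<not> qbounded (X - {c}) (flat_dist \<rho> c)
    \<and> ahlfors_regular Q (X - {c}) (flat_dist \<rho> c) (flat_measure X \<rho> M c)"
proof -
  have qm: "quasi_metric K X \<rho>" and bor: "qborel X \<rho> \<subseteq> sets M"
    and fin: "\<And>x r. \<lbrakk>x \<in> X; r > 0\<rbrakk> \<Longrightarrow> outer_measure_of M (qball X \<rho> x r) < \<infinity>"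
    using assms(3) by (auto simp: quasi_metric_measure_space_def)
  obtain D where D: "0 \<le> D" "qdiam X \<rho> = ennreal D"
    using assms(4) by (cases "qdiam X \<rho>") (auto simp: qbounded_def)
  have diam: "\<rho> x y \<le> D" if "x \<in> X" "y \<in> X" for x y
  proof -
    have "ennreal (\<rho> x y) \<le> qdiam X \<rho>"
      using that by (rule le_qdiam)
    then show ?thesis using D by (simp add: ennreal_le_iff)
  qed
  \<comment> \<open>A second point makes \<open>D\<close> positive. If \<open>c\<close> were the
    only point, the flattening would be empty and hence bounded.\<close>
  obtain w where w: "w \<in> X" "w \<noteq> c" using assms(6,7) by blast
  have "0 < \<rho> w c" using qm w assms(6) by (simp add: quasi_metric_def less_le)
  then have D0: "D > 0" using diam[OF w(1) assms(6)] by simp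
  obtain C0 where C0: "C0 \<ge> 1"
    and low: "\<And>x R. \<lbrakk>x \<in> X; R > 0; R < D\<rbrakk> \<Longrightarrow> ennreal (inverse C0 * R powr Q) \<le> outer_measure_of M (qball X \<rho> x R)"
    and upp: "\<And>x R. \<lbrakk>x \<in> X; R > 0; R < D\<rbrakk> \<Longrightarrow> outer_measure_of M (qball X \<rho> x R) \<le> ennreal (C0 * R powr Q)"
    using assms(5) D by (auto simp: ahlfors_regular_def ennreal_less_iff)
  \<comment> \<open>Boundedness makes \<open>X\<close> itself a ball, so finiteness on balls gives
    finite total mass.\<close>
  have "qball X \<rho> c (D + 1) = X" using diam assms(6) by (force simp: qball_def)
  then have "outer_measure_of M X < \<infinity>" using fin[of c "D + 1"] assms(6) D by simp
  then obtain m where m: "0 \<le> m" "outer_measure_of M X = ennreal m"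
    by (cases "outer_measure_of M X") auto
  (* The regularity hypothesis only covers radii below D; the factor 2 powr Q extends the lower
     bound to radius D, and the finite total mass m gives the upper bound for large radii. *)
  define C where "C = max (C0 * 2 powr Q) (m / D powr Q)"
  have C: "C0 * 2 powr Q \<le> C" "m / D powr Q \<le> C" by (auto simp: C_def)
  have "1 \<le> 2 powr Q" using assms(1) by (intro ge_one_powr_ge_zero) auto
  then have "C0 * 1 \<le> C0 * 2 powr Q" using C0 by (intro mult_left_mono) auto
  then have C0C: "C0 \<le> C" using C by simp
  interpret pointed_ahlfors K X \<rho> c D M Q C
  proof unfold_locales
    show "C > 0" using C0 C0C by simp
    fix x r assume x: "x \<in> X" and r: "r > (0 :: real)"
    show "outer_measure_of M (qball X \<rho> x r) \<le> ennreal (C * r powr Q)"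
    proof (cases "r < D")
      case True
      have "ennreal (C0 * r powr Q) \<le> ennreal (C * r powr Q)"
        using C0C by (intro ennreal_leI mult_right_mono) auto
      with upp[OF x r True] show ?thesis by (rule order_trans)
    next
      case False
      have "outer_measure_of M (qball X \<rho> x r) \<le> ennreal m"
        unfolding m(2)[symmetric] by (rule outer_measure_of_mono) (auto simp: qball_def)
      also have "m = m / D powr Q * D powr Q" using D0 by simp
      also have "ennreal \<dots> \<le> ennreal (C * r powr Q)"
        using C(2) C0 C0C False D0 assms(1)
        by (intro ennreal_leI mult_mono powr_mono2) auto
      finally show ?thesis .
    qed
    assume "r \<le> D"
    have "r powr Q / C \<le> r powr Q / (C0 * 2 powr Q)"
      using C(1) C0 C0C by (intro divide_left_mono mult_pos_pos) auto
    also have "\<dots> = inverse C0 * (r / 2) powr Q" by (simp add: powr_divide field_simps)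
    finally have "ennreal (r powr Q / C) \<le> ennreal (inverse C0 * (r / 2) powr Q)"
      by (rule ennreal_leI)
    also have "\<dots> \<le> outer_measure_of M (qball X \<rho> x (r / 2))"
      using x r \<open>r \<le> D\<close> by (intro low) auto
    also have "\<dots> \<le> outer_measure_of M (qball X \<rho> x r)"
      using r by (intro outer_measure_of_mono) (auto simp: qball_def)
    finally show "ennreal (r powr Q / C) \<le> outer_measure_of M (qball X \<rho> x r)" .
  qed (use assms qm bor D0 diam in auto)
  show ?thesis
    using flat_measure_space flat_ahlfors flat_unbounded by (simp add: qbounded_def)
qed

end
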